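(* Let $C$ be an extremal Type II code of length $n$ (so $8\mid n$), and let $\mathrm{t}(n)=5$ if $n\equiv0\bmod 24$, $\mathrm{t}(n)=3$ if $n\equiv8\bmod24$, and $\mathrm{t}(n)=1$ if $n\equiv16\bmod24$. Then for each positive integer $t\le\mathrm{t}(n)$ and any $w$, the set $C_w$ of codewords of $C$ of weight $w$ is a $t$-design.
   Context: A binary linear code of length $n$ is a subspace $C\subseteq\mathbb{F}_2^n$; $\mathrm{wt}(c)$ is the number of nonzero coordinates of $c$. $C$ is of Type II if $C=C^\perp$ (with respect to $(v,w)=\sum_jv_jw_j$) and $\mathrm{wt}(c)\equiv0\bmod4$ for all $c\in C$; then $8\mid n$. A Type II code $C$ of length $n$ is extremal if its minimal nonzero weight equals $4\lfloor n/24\rfloor+4$ (the maximal possible value). A $t$-$(n,w,\lambda)$-design is a (possibly empty) collection $D$ of distinct $w$-element subsets of $\{1,\dots,n\}$ such that $|\{S'\in D:S\subseteq S'\}|=\lambda$ for every $S\subset\{1,\dots,n\}$ with $|S|=t$; a $t$-design is a $t$-$(n,w,\lambda)$-design for some $\lambda$. A word of weight $w$ is identified with the $w$-element set of coordinates on which it equals $1$. *)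

theory Defs
  imports "HOL-Analysis.Analysis" "HOL-Library.Z2"
begin

(* Codes of length n are sets of vectors over the two-element field bit; the coordinates
   are the elements of a finite index type 'n, and n = CARD('n). *)

definition binary_linear_code :: "(bit ^ 'n::finite) set \<Rightarrow> bool" where
  "binary_linear_code C \<longleftrightarrow> vec.subspace C"

definition supp :: "bit ^ 'n::finite \<Rightarrow> 'n set" where
  "supp c = {j. c $ j = 1}"

definition wt :: "bit ^ 'n::finite \<Rightarrow> nat" where
  "wt c = card {j. c $ j \<noteq> 0}"

definition pairing :: "bit ^ 'n::finite \<Rightarrow> bit ^ 'n \<Rightarrow> bit" where
  "pairing v w = (\<Sum>j\<in>UNIV. v $ j * w $ j)"

definition dual_code :: "(bit ^ 'n::finite) set \<Rightarrow> (bit ^ 'n) set" where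
  "dual_code C = {v. \<forall>c\<in>C. pairing v c = 0}"

definition type_II :: "(bit ^ 'n::finite) set \<Rightarrow> bool" where
  "type_II C \<longleftrightarrow> binary_linear_code C \<and> C = dual_code C \<and> (\<forall>c\<in>C. 4 dvd wt c)"

(* The set under Min is nonempty for every self-dual C: the index type is nonempty, so
   the zero code is not self-dual. *)
definition min_weight :: "(bit ^ 'n::finite) set \<Rightarrow> nat" where
  "min_weight C = Min (wt ` (C - {0}))"

definition extremal_type_II :: "(bit ^ 'n::finite) set \<Rightarrow> bool" where
  "extremal_type_II C \<longleftrightarrow> type_II C \<and> min_weight C = 4 * (CARD('n) div 24) + 4"

definition words_of_weight :: "(bit ^ 'n::finite) set \<Rightarrow> nat \<Rightarrow> (bit ^ 'n) set" where
  "words_of_weight C w = {c \<in> C. wt c = w}"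

(* A t-(n,w,l)-design on the n = CARD('n) points of the type 'n. *)
definition design :: "nat \<Rightarrow> nat \<Rightarrow> nat \<Rightarrow> 'n::finite set set \<Rightarrow> bool" where
  "design t w l D \<longleftrightarrow>
     (\<forall>B\<in>D. card B = w) \<and> (\<forall>S. card S = t \<longrightarrow> card {B \<in> D. S \<subseteq> B} = l)"

definition t_design :: "nat \<Rightarrow> nat \<Rightarrow> 'n::finite set set \<Rightarrow> bool" where
  "t_design t w D \<longleftrightarrow> (\<exists>l. design t w l D)"

(* Type II codes have length divisible by 8, so the last value 0 never occurs for them. *)
definition design_strength :: "nat \<Rightarrow> nat" where
  "design_strength n =
     (if n mod 24 = 0 then 5 else if n mod 24 = 8 then 3 else if n mod 24 = 16 then 1 else 0)"

end

theory Submission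
  imports Defs
begin

text \<open>
  A self-dual code of minimum weight \<open>d\<close> is an orthogonal array of strength \<open>d - 1\<close>: for
  \<open>card J < d\<close> the proportion of codewords equal to 1 on all of \<open>J\<close> is \<open>2 ^ - card J\<close>.
  Hence, for a polynomial \<open>p\<close> of degree less than \<open>d - t\<close>, the sum of \<open>p (wt c)\<close>
  over the codewords \<open>c\<close> covering a \<open>t\<close>-set \<open>T\<close> does not depend on \<open>T\<close>. As the code contains
  the all-one word, its weights other than 0 and \<open>n\<close> lie in \<open>{d, d + 4, \<dots>, n - d}\<close>, and for an
  extremal code this set has at most \<open>d - t\<close> elements, so the polynomial vanishing at all but
  one of them isolates the codewords of that weight.
\<close>

section \<open>Words and their supports\<close>

lemma supp_subset_iff: "J \<subseteq> supp c \<longleftrightarrow> (\<forall>j\<in>J. c $ j = 1)"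
  by (auto simp: supp_def)

lemma card_supp: "card (supp c) = wt c"
  by (simp add: supp_def wt_def)

lemma inj_supp: "inj supp"
proof (rule injI)
  fix x y :: "bit ^ 'n::finite"
  assume "supp x = supp y"
  then have "x $ j = 1 \<longleftrightarrow> y $ j = 1" for j by (auto simp: supp_def)
  then show "x = y" by (metis bit_not_one_iff vec_eq_iff)
qed

lemma finite_code: "finite (C :: (bit ^ 'n::finite) set)"
  using finite_imageD[of supp C] inj_on_subset[OF inj_supp] by auto

section \<open>Character sums over a linear code\<close>

definition ind :: "'n set \<Rightarrow> bit ^ 'n::finite" where
  "ind I = (\<chi> j. if j \<in> I then 1 else 0)"

lemma wt_ind: "wt (ind I) = card I"
  by (simp add: wt_def ind_def)

lemma pairing_ind: "pairing (ind I) c = (\<Sum>j\<in>I. c $ j)"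
  unfolding pairing_def ind_def
  by (rule sum.mono_neutral_cong_right) auto

text \<open>The nontrivial additive character of the two-element field.\<close>

definition sgn_bit :: "bit \<Rightarrow> real" where
  "sgn_bit b = (if b = 0 then 1 else - 1)"

lemma sgn_bit_add: "sgn_bit (a + b) = sgn_bit a * sgn_bit b"
  by (cases a; cases b) (simp_all add: sgn_bit_def)

lemma sgn_bit_sum: "finite I \<Longrightarrow> sgn_bit (\<Sum>j\<in>I. f j) = (\<Prod>j\<in>I. sgn_bit (f j))"
  by (induction I rule: finite_induct)
    (simp_all add: sgn_bit_add sgn_bit_def[of 0] del: add_bit_eq_xor)

text \<open>Translation by a codeword not orthogonal to \<open>v\<close> permutes \<open>C\<close>
  and flips every sign, so the sum equals its own negative.\<close>

lemma character_sum_eq_0: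
  fixes C :: "(bit ^ 'n::finite) set"
  assumes C: "binary_linear_code C" and v: "v \<notin> dual_code C"
  shows "(\<Sum>c\<in>C. sgn_bit (pairing v c)) = 0"
proof -
  obtain c0 where c0: "c0 \<in> C" "pairing v c0 \<noteq> 0"
    using v by (auto simp: dual_code_def)
  have add: "x + y \<in> C" if "x \<in> C" "y \<in> C" for x y
    using C that by (simp add: binary_linear_code_def vec.subspace_def)
  have self: "c0 + c0 = 0"
    by (simp add: vec_eq_iff)
  have "(\<Sum>c\<in>C. sgn_bit (pairing v c)) = (\<Sum>c\<in>C. sgn_bit (pairing v (c + c0)))"
    by (rule sum.reindex_bij_witness[of _ "\<lambda>c. c + c0" "\<lambda>c. c + c0"])
      (auto simp: add c0 self add.assoc)
  also have "\<dots> = (\<Sum>c\<in>C. - sgn_bit (pairing v c))"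
  proof (rule sum.cong[OF refl])
    fix c
    have "pairing v (c + c0) = pairing v c + pairing v c0"
      by (simp add: pairing_def distrib_left sum.distrib del: add_bit_eq_xor mult_bit_eq_and)
    then show "sgn_bit (pairing v (c + c0)) = - sgn_bit (pairing v c)"
      using c0 by (simp only: sgn_bit_add) (simp add: sgn_bit_def)
  qed
  finally show ?thesis by (simp add: sum_negf)
qed

text \<open>Fourier expansion of the covering condition: summed over \<open>C\<close>, the
  characters of nonempty \<open>I\<close> cancel, because a nonzero word of weight below
  \<open>d\<close> lies outside the dual. Only \<open>I = {}\<close> contributes.\<close>

lemma orthogonal_array:
  fixes C :: "(bit ^ 'n::finite) set"
  assumes C: "binary_linear_code C"
    and d: "\<And>c. c \<in> dual_code C \<Longrightarrow> c \<noteq> 0 \<Longrightarrow> d \<le> wt c"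
    and J: "card J < d"
  shows "real (card {c \<in> C. J \<subseteq> supp c}) = real (card C) / 2 ^ card J"
proof -
  have indicator: "(if J \<subseteq> supp c then 1 else 0) * 2 ^ card J =
      (\<Sum>I\<in>Pow J. (- 1) ^ card I * sgn_bit (pairing (ind I) c))" for c
  proof -
    \<comment> \<open>Each factor is 2 if \<open>c $ j = 1\<close> and 0 otherwise.\<close>
    have "(if J \<subseteq> supp c then 1 else 0) * 2 ^ card J = (\<Prod>j\<in>J. - sgn_bit (c $ j) + 1)"
    proof (cases "J \<subseteq> supp c")
      case True
      then show ?thesis by (simp add: supp_subset_iff sgn_bit_def)
    next
      case False
      then obtain j where "j \<in> J" "c $ j = 0" by (auto simp: supp_subset_iff)
      then have "(\<Prod>j\<in>J. - sgn_bit (c $ j) + 1) = 0"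
        by (intro prod_zero) (auto simp: sgn_bit_def)
      then show ?thesis using False by simp
    qed
    also have "\<dots> = (\<Sum>I\<in>Pow J. \<Prod>j\<in>I. - sgn_bit (c $ j))"
      by (subst prod_add) simp_all
    also have "\<dots> = (\<Sum>I\<in>Pow J. (- 1) ^ card I * sgn_bit (pairing (ind I) c))"
      by (simp add: prod_uminus pairing_ind sgn_bit_sum)
    finally show ?thesis .
  qed
  have zero: "(\<Sum>c\<in>C. sgn_bit (pairing (ind I) c)) = (if I = {} then real (card C) else 0)"
    if "I \<subseteq> J" for I
  proof (cases "I = {}")
    case True
    then show ?thesis by (simp add: pairing_ind sgn_bit_def)
  next
    case False
    have "wt (ind I) < d"
      using J card_mono[OF _ that] by (simp add: wt_ind)
    moreover have "ind I \<noteq> 0"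
      using False by (auto simp: ind_def vec_eq_iff)
    ultimately have "ind I \<notin> dual_code C" using d by force
    then show ?thesis using character_sum_eq_0[OF C] False by simp
  qed
  have "real (card {c \<in> C. J \<subseteq> supp c}) * 2 ^ card J
      = (\<Sum>c\<in>C. (if J \<subseteq> supp c then 1 else 0) * 2 ^ card J)"
    by (simp add: sum.If_cases finite_code Int_def flip: sum_distrib_right)
  also have "\<dots> = (\<Sum>I\<in>Pow J. (- 1) ^ card I * (\<Sum>c\<in>C. sgn_bit (pairing (ind I) c)))"
    by (simp only: indicator sum_distrib_left) (rule sum.swap)
  also have "\<dots> = (\<Sum>I\<in>Pow J. if I = {} then real (card C) else 0)"
    by (intro sum.cong) (auto simp: zero)
  also have "\<dots> = real (card C)"
    by simp
  finally show ?thesis by (simp add: field_simps)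
qed

section \<open>Moments of the weights of covering words\<close>

text \<open>Each factor \<open>wt c - a\<close> is traded for at most one more covered coordinate,
  so \<open>card J + card A\<close> never grows, until only the orthogonal array count remains. The
  induction leaves \<open>J\<close> and \<open>J'\<close> arbitrary because they are
  enlarged.\<close>

lemma covering_moment_eq:
  fixes C :: "(bit ^ 'n::finite) set" and A :: "nat set"
  assumes C: "binary_linear_code C"
    and d: "\<And>c. c \<in> dual_code C \<Longrightarrow> c \<noteq> 0 \<Longrightarrow> d \<le> wt c"
    and A: "finite A" and eq: "card J = card J'" and lt: "card J + card A < d"
  shows "(\<Sum>c | c \<in> C \<and> J \<subseteq> supp c. \<Prod>a\<in>A. real (wt c) - real a)
       = (\<Sum>c | c \<in> C \<and> J' \<subseteq> supp c. \<Prod>a\<in>A. real (wt c) - real a)"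
  using A eq lt
proof (induction A arbitrary: J J' rule: finite_induct)
  case empty
  then show ?case
    using orthogonal_array[OF C d, of J] orthogonal_array[OF C d, of J'] by simp
next
  case (insert a A)
  define q where "q c = (\<Prod>a\<in>A. real (wt c) - real a)" for c :: "bit ^ 'n"
  define M where "M K = (\<Sum>c | c \<in> C \<and> K \<subseteq> supp c. q c)" for K
  have IH: "M K = M K'" if "card K = card K'" "card K + card A < d" for K K'
    using insert.IH[OF that] by (simp add: M_def q_def)
  have less: "card J + card A < d" and less_Suc: "Suc (card J) + card A < d"
    using insert by simp_all
  \<comment> \<open>Multiplying by \<open>wt c\<close> amounts to summing over an additional covered coordinate.\<close>
  have step: "(\<Sum>c | c \<in> C \<and> K \<subseteq> supp c. \<Prod>a\<in>insert a A. real (wt c) - real a)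
      = (real (card K) - real a) * M K + (\<Sum>j\<in>- K. M (insert j K))" for K
  proof -
    have "(\<Sum>c | c \<in> C \<and> K \<subseteq> supp c. real (wt c) * q c)
        = (\<Sum>c | c \<in> C \<and> K \<subseteq> supp c. \<Sum>j\<in>UNIV. if j \<in> supp c then q c else 0)"
      by (simp add: sum.If_cases card_supp)
    also have "\<dots> = (\<Sum>j\<in>UNIV. \<Sum>c | c \<in> C \<and> K \<subseteq> supp c. if j \<in> supp c then q c else 0)"
      by (rule sum.swap)
    also have "\<dots> = (\<Sum>j\<in>UNIV. M (insert j K))"
      unfolding M_def
      by (intro sum.cong[OF refl] sum.mono_neutral_cong_right) (auto simp: finite_code)
    also have "\<dots> = (\<Sum>j\<in>K. M (insert j K)) + (\<Sum>j\<in>- K. M (insert j K))"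
      by (subst sum.union_disjoint[symmetric]) auto
    also have "(\<Sum>j\<in>K. M (insert j K)) = real (card K) * M K"
      by (simp add: insert_absorb)
    finally have wt_q: "(\<Sum>c | c \<in> C \<and> K \<subseteq> supp c. real (wt c) * q c)
        = real (card K) * M K + (\<Sum>j\<in>- K. M (insert j K))" .
    have "(\<Sum>c | c \<in> C \<and> K \<subseteq> supp c. \<Prod>a\<in>insert a A. real (wt c) - real a)
        = (\<Sum>c | c \<in> C \<and> K \<subseteq> supp c. real (wt c) * q c) - real a * M K"
      using insert.hyps
      by (simp add: q_def M_def left_diff_distrib sum_subtractf sum_distrib_left)
    then show ?thesis unfolding wt_q by (simp add: left_diff_distrib)
  qed
  have const: "(\<Sum>j\<in>- K. M (insert j K)) = real (card (- K)) * m"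
    if "\<And>j. j \<notin> K \<Longrightarrow> M (insert j K) = m" for K m
    using that by simp
  show ?case
  \<comment> \<open>The main case picks a coordinate outside \<open>J\<close>. If there is none,
    \<open>J'\<close> is also the full set.\<close>
  proof (cases "- J = {}")
    case True
    then have "J = J'"
      using insert.prems(1) by (metis card_subset_eq Compl_empty_eq double_compl finite subset_UNIV)
    then show ?thesis by simp
  next
    case False
    then obtain j where j: "j \<notin> J" by auto
    \<comment> \<open>Every set obtained from \<open>J\<close> or \<open>J'\<close> by adding an
      outside coordinate has \<open>card J + 1\<close> elements, so all these sums share one
      value.\<close>
    have c1: "(\<Sum>i\<in>- J. M (insert i J)) = real (card (- J)) * M (insert j J)"
      using j less_Suc by (intro const IH) auto
    have c2: "(\<Sum>i\<in>- J'. M (insert i J')) = real (card (- J')) * M (insert j J)"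
      using j less_Suc insert.prems(1) by (intro const IH) auto
    have "card (- J) = card (- J')"
      using insert.prems(1) by (simp add: Compl_eq_Diff_UNIV card_Diff_subset)
    then show ?thesis
      unfolding step c1 c2 using IH[OF insert.prems(1) less] insert.prems(1) by simp
  qed
qed

section \<open>Weights in extremal Type II codes\<close>

text \<open>Pairing with the all-one word gives the weight mod 2, which is 0 here; self-duality then
  puts that word in \<open>C\<close>.\<close>

lemma type_II_one_in:
  fixes C :: "(bit ^ 'n::finite) set"
  assumes "type_II C"
  shows "ind UNIV \<in> C"
proof -
  have "pairing (ind UNIV) c = 0" if "c \<in> C" for c
  proof -
    have "pairing (ind UNIV) c = of_nat (wt c)"
      unfolding pairing_ind
      by (subst sum.mono_neutral_right[of _ "supp c"]) (auto simp: supp_def wt_def)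
    moreover have "even (wt c)"
      using assms that dvd_trans[of 2 4 "wt c"] by (simp add: type_II_def)
    ultimately show ?thesis by (auto elim!: evenE)
  qed
  then show ?thesis using assms by (auto simp: type_II_def dual_code_def)
qed

lemma wt_complement: "wt (ind UNIV + c :: bit ^ 'n::finite) + wt c = CARD('n)"
proof -
  have "{j. (ind UNIV + c) $ j \<noteq> 0} = - {j. c $ j \<noteq> 0}"
    by (auto simp: ind_def)
  then have "wt (ind UNIV + c) = CARD('n) - wt c"
    by (simp add: wt_def Compl_eq_Diff_UNIV card_Diff_subset)
  then show ?thesis by (simp add: wt_def card_mono)
qed

lemma wt_eq_CARD_iff: "wt (c :: bit ^ 'n::finite) = CARD('n) \<longleftrightarrow> supp c = UNIV"
  by (metis card_subset_eq card_supp finite subset_UNIV)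

lemma extremal_min_weight:
  assumes "extremal_type_II C" "c \<in> C" "c \<noteq> 0"
  shows "4 * (CARD('n) div 24) + 4 \<le> wt (c :: bit ^ 'n::finite)"
proof -
  have "min_weight C \<le> wt c"
    unfolding min_weight_def using assms(2,3) by (intro Min_le) (auto simp: finite_code)
  then show ?thesis using assms(1) by (simp add: extremal_type_II_def)
qed

text \<open>The complement of a codeword is again a codeword, so the lower bound \<open>d\<close> on
  nonzero weights also bounds the weights from above.\<close>

lemma extremal_weight_cases:
  fixes C :: "(bit ^ 'n::finite) set"
  defines "d \<equiv> 4 * (CARD('n) div 24) + 4"
  assumes C: "extremal_type_II C" and c: "c \<in> C"
  shows "wt c = 0 \<or> wt c = CARD('n) \<or> wt c \<in> {a. 4 dvd a \<and> d \<le> a \<and> a + d \<le> CARD('n)}"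
proof -
  have II: "type_II C" using C by (simp add: extremal_type_II_def)
  have "d \<le> CARD('n) - wt c" if "wt c \<noteq> CARD('n)"
  proof -
    have "ind UNIV + c \<in> C"
      using type_II_one_in[OF II] c II
      by (simp add: type_II_def binary_linear_code_def vec.subspace_def)
    moreover have "ind UNIV + c \<noteq> 0"
    proof
      assume "ind UNIV + c = 0"
      then have "wt (ind UNIV + c) = 0" by (simp only:) (simp add: wt_def)
      then show False using that wt_complement[of c] by simp
    qed
    ultimately have "d \<le> wt (ind UNIV + c)"
      using extremal_min_weight[OF C] by (simp add: d_def)
    then show ?thesis using wt_complement[of c] by simp
  qed
  moreover have "d \<le> wt c" if "wt c \<noteq> 0"
  proof -
    have "c \<noteq> 0" using that by (auto simp: wt_def)
    then show ?thesis using extremal_min_weight[OF C c] by (simp add: d_def)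
  qed
  moreover have "4 dvd wt c" using II c by (simp add: type_II_def)
  moreover have "wt c \<le> CARD('n)" using wt_complement[of c] by simp
  ultimately show ?thesis by (auto simp: d_def)
qed

text \<open>With \<open>m = n div 24\<close>, the residues 0, 8, 16 leave \<open>4 * m - 1\<close>,
  \<open>4 * m + 1\<close>, \<open>4 * m + 3\<close> weights; subtracting from
  \<open>d = 4 * m + 4\<close> gives exactly 5, 3, 1.\<close>

lemma card_middle_weights:
  fixes n t :: nat
  defines "d \<equiv> 4 * (n div 24) + 4"
  assumes t: "0 < t" "t \<le> design_strength n" and n: "0 < n"
  shows "card {a. 4 dvd a \<and> d \<le> a \<and> a + d \<le> n} + t \<le> d"
proof -
  let ?W = "{a. 4 dvd a \<and> d \<le> a \<and> a + d \<le> n}"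
  have n_eq: "n = 24 * (n div 24) + n mod 24" by simp
  \<comment> \<open>Positivity of \<open>n\<close> excludes \<open>n div 24 = 0\<close> in the first
    case, where \<open>d = 4\<close> would be less than 5.\<close>
  consider "n mod 24 = 0" "t \<le> 5" "1 \<le> n div 24"
    | "n mod 24 = 8" "t \<le> 3" | "n mod 24 = 16" "t \<le> 1"
    using t n by (auto simp: design_strength_def split: if_splits)
  \<comment> \<open>The inequality says that the term of index \<open>d - t\<close> in the
    progression \<open>d, d + 4, ...\<close> already exceeds \<open>n - d\<close>.\<close>
  then have "t \<le> d \<and> n < d + 4 * (d - t) + d"
    unfolding d_def using n_eq by cases linarith+
  then have td: "t \<le> d" and gap: "n < d + 4 * (d - t) + d" by auto
  have "?W \<subseteq> (\<lambda>i. d + 4 * i) ` {..<d - t}"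
  proof
    fix a assume a: "a \<in> ?W"
    then have "4 dvd a - d" unfolding d_def by auto
    then obtain i where "a - d = 4 * i" by (rule dvdE)
    then have "a = d + 4 * i" "i < d - t" using a gap by auto
    then show "a \<in> (\<lambda>i. d + 4 * i) ` {..<d - t}" by blast
  qed
  then have "card ?W \<le> card {..<d - t}" by (rule surj_card_le[rotated]) simp
  then show ?thesis using td by simp
qed

section \<open>Isolating a single weight\<close>

lemma extremal_covering_count:
  fixes C :: "(bit ^ 'n::finite) set"
  assumes C: "extremal_type_II C"
    and t: "0 < t" "t \<le> design_strength CARD('n)"
    and T: "card T = t" and T': "card T' = t"
  shows "card {c \<in> C. wt c = w \<and> T \<subseteq> supp c} = card {c \<in> C. wt c = w \<and> T' \<subseteq> supp c}"
proof -
  define d where "d = 4 * (CARD('n) div 24) + 4"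
  define W where "W = {a. 4 dvd a \<and> d \<le> a \<and> a + d \<le> CARD('n)}"
  \<comment> \<open>Weight 0 drops out because \<open>S\<close> is nonempty.\<close>
  have weights: "wt c = CARD('n) \<or> wt c \<in> W"
    if "c \<in> C" "S \<subseteq> supp c" "card S = t" for c S
    using extremal_weight_cases[OF C \<open>c \<in> C\<close>] card_mono[OF _ \<open>S \<subseteq> supp c\<close>] that t
    by (auto simp: W_def d_def card_supp)
  consider "w = CARD('n)" | "w \<in> W" | "w \<noteq> CARD('n)" "w \<notin> W" by blast
  then show ?thesis
  proof cases
    case 1
    then have "{c \<in> C. wt c = w \<and> S \<subseteq> supp c} = {c \<in> C. wt c = w}" for S
      by (auto simp: wt_eq_CARD_iff)
    then show ?thesis by simp
  next
    case 3
    then have empty: "{c \<in> C. wt c = w \<and> S \<subseteq> supp c} = {}" if "card S = t" for S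
      using weights that by auto
    show ?thesis unfolding empty[OF T] empty[OF T'] ..
  next
    case 2
    define A where "A = W - {w}"
    define p where "p x = (\<Prod>a\<in>A. real x - real a)" for x
    have "finite W" by (rule finite_subset[of _ "{..CARD('n)}"]) (auto simp: W_def)
    then have finA: "finite A" and cardA: "card W = Suc (card A)"
      using 2 card_Suc_Diff1[of W w] by (auto simp: A_def)
    have "card W + t \<le> d"
      using card_middle_weights[OF t] by (simp add: W_def d_def)
    \<comment> \<open>Omitting \<open>w\<close> from \<open>W\<close> lowers the degree by one,
      which makes the bound strict.\<close>
    then have lt: "card T + card A < d" using cardA T by simp
    have w_ne: "w \<noteq> CARD('n)" using 2 by (auto simp: W_def d_def)
    have pw: "p w \<noteq> 0" using finA by (simp add: p_def A_def)
    \<comment> \<open>\<open>p\<close> need not vanish at \<open>CARD('n)\<close>, but a word of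
      full weight covers every \<open>S\<close>, so its term is the same for all
      \<open>S\<close>.\<close>
    have count: "(\<Sum>c | c \<in> C \<and> S \<subseteq> supp c. p (wt c))
        = real (card {c \<in> C. wt c = w \<and> S \<subseteq> supp c}) * p w
          + real (card {c \<in> C. wt c = CARD('n)}) * p CARD('n)" if S: "card S = t" for S
    proof -
      let ?X = "{c \<in> C. wt c = w \<and> S \<subseteq> supp c}" and ?Y = "{c \<in> C. wt c = CARD('n)}"
      have "(\<Sum>c | c \<in> C \<and> S \<subseteq> supp c. p (wt c)) = (\<Sum>c\<in>?X \<union> ?Y. p (wt c))"
      proof (rule sum.mono_neutral_right)
        show "\<forall>c\<in>{c. c \<in> C \<and> S \<subseteq> supp c} - (?X \<union> ?Y). p (wt c) = 0"
        proof
          fix c assume "c \<in> {c. c \<in> C \<and> S \<subseteq> supp c} - (?X \<union> ?Y)"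
          then have "wt c \<in> A" using weights S by (auto simp: A_def)
          then show "p (wt c) = 0" using finA by (auto simp: p_def)
        qed
      qed (auto simp: finite_code wt_eq_CARD_iff)
      also have "\<dots> = (\<Sum>c\<in>?X. p (wt c)) + (\<Sum>c\<in>?Y. p (wt c))"
        using w_ne by (intro sum.union_disjoint) (auto simp: finite_code)
      finally show ?thesis by simp
    qed
    have II: "binary_linear_code C" "C = dual_code C"
      using C by (simp_all add: extremal_type_II_def type_II_def)
    have "d \<le> wt c" if "c \<in> dual_code C" "c \<noteq> 0" for c
      using extremal_min_weight[OF C] that II(2) by (auto simp: d_def)
    then have "(\<Sum>c | c \<in> C \<and> T \<subseteq> supp c. p (wt c)) = (\<Sum>c | c \<in> C \<and> T' \<subseteq> supp c. p (wt c))"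
      unfolding p_def using T T' by (intro covering_moment_eq[OF II(1) _ finA _ lt]) auto
    then show ?thesis using count[OF T] count[OF T'] pw by simp
  qed
qed

theorem theorem7p4:
  fixes C :: "(bit ^ 'n::finite) set" and t w :: nat
  assumes "extremal_type_II C"
    and "0 < t" and "t \<le> design_strength CARD('n)"
  shows "t_design t w (supp ` words_of_weight C w)"
proof -
  let ?D = "supp ` words_of_weight C w"
  have count: "card {B \<in> ?D. S \<subseteq> B} = card {c \<in> C. wt c = w \<and> S \<subseteq> supp c}" for S
  proof -
    have "{B \<in> ?D. S \<subseteq> B} = supp ` {c \<in> C. wt c = w \<and> S \<subseteq> supp c}"
      by (auto simp: words_of_weight_def)
    then show ?thesis
      by (simp add: card_image inj_on_subset[OF inj_supp])
  qed
  \<comment> \<open>A reference set whose count serves as the design parameter. If no set has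
    \<open>t\<close> elements, \<open>T\<close> is arbitrary and the condition is vacuous.\<close>
  define T :: "'n set" where "T = (SOME T. card T = t)"
  have "card {B \<in> ?D. S \<subseteq> B} = card {B \<in> ?D. T \<subseteq> B}" if "card S = t" for S
    unfolding count using that someI[of "\<lambda>T :: 'n set. card T = t", OF that]
    by (intro extremal_covering_count[OF assms]) (simp_all add: T_def)
  moreover have "\<forall>B\<in>?D. card B = w"
    by (auto simp: words_of_weight_def card_supp)
  ultimately show ?thesis by (auto simp: t_design_def design_def)
qed

end
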